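(* Solutions of the complex Riccati equation $\Theta'(z)+\Theta^2(z)+h(z)=0$ with any holomorphic $h$ are geodesic curves in the two-dimensional geometry of a complex sphere with imaginary unit radius. More precisely: let $h$ be holomorphic on an open set $\mathcal{U}\subset\mathbb{C}$, let $\mathcal{U}_0\subset\mathcal{U}$ be open, and let $X:\mathcal{U}_0\to\mathbb{C}\setminus\{0\}$ be holomorphic with $h(z)\neq X^2(z)$ on $\mathcal{U}_0$. If either $\Theta=iX$ or $\Theta=-iX$ is a solution of $$\Theta'(z)+\Theta^2(z)+h(z)=0$$ on $\mathcal{U}_0$, then $X$ is a solution on $\mathcal{U}_0$ of $$X''(z)=\frac{3X^{2}(z)+h(z)}{X^{2}(z)-h(z)}\,\frac{[X'(z)]^{2}}{X(z)}-\frac{h'(z)X'(z)}{X^{2}(z)-h(z)}+\frac{X^{4}(z)-h^{2}(z)}{X(z)}.$$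
   Context: The displayed second order equation for $X$ is the equation of geodesic curves in explicit form on the complex Riemannian manifold $\mathbb{M}_h^{\mathbb C}=(\mathcal{H}_{\mathbb C},G_h)$, where $\mathcal{H}_{\mathbb C}=\{(z,\mathfrak{X})\in\mathcal{U}\times(\mathbb{C}\setminus\{0\}):\mathfrak{X}^2\neq h(z)\}$ and $G_h=\mathfrak{X}^{-2}\left[(h(z)-\mathfrak{X}^2)^2dz^2+d\mathfrak{X}^2\right]$, which is locally holomorphically isometric to the complex $2$-sphere $(Z^1)^2+(Z^2)^2+(Z^3)^2=i^2$ in $\mathbb{C}^3$. Here "explicit form" means: for a complex geodesic $\upsilon\mapsto(z(\upsilon),\mathfrak{X}(\upsilon))$ with $\dot z(\upsilon)\neq0$ near $\upsilon=0$, one writes $\mathfrak{X}(\upsilon)=X(z(\upsilon))$. *)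

theory Defs
  imports "HOL-Complex_Analysis.Complex_Analysis"
begin

definition riccati_solution :: "(complex \<Rightarrow> complex) \<Rightarrow> complex set \<Rightarrow> (complex \<Rightarrow> complex) \<Rightarrow> bool" where
  "riccati_solution h S \<Theta> \<longleftrightarrow>
     \<Theta> holomorphic_on S \<and> (\<forall>z\<in>S. deriv \<Theta> z + (\<Theta> z)\<^sup>2 + h z = 0)"

text \<open>
  Complex Riemannian geometry in one global chart: points are vectors in \<open>complex ^ 'n\<close>, and a
  metric is given by its matrix of components, complex bilinear and symmetric (no conjugation).
\<close>

definition partial_deriv :: "'n \<Rightarrow> (complex ^ 'n \<Rightarrow> complex) \<Rightarrow> complex ^ 'n \<Rightarrow> complex" where
  "partial_deriv k f p = deriv (\<lambda>t. f (\<chi> i. if i = k then t else p $ i)) (p $ k)"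

text \<open>\<open>christoffel g k i j p\<close> is the symbol of the Levi-Civita connection with upper index \<open>k\<close>.\<close>

definition christoffel ::
  "(complex ^ 'n \<Rightarrow> complex ^ 'n ^ 'n) \<Rightarrow> 'n::finite \<Rightarrow> 'n \<Rightarrow> 'n \<Rightarrow> complex ^ 'n \<Rightarrow> complex" where
  "christoffel g k i j p =
     (\<Sum>l\<in>UNIV. matrix_inv (g p) $ k $ l *
        (partial_deriv i (\<lambda>q. g q $ j $ l) p
         + partial_deriv j (\<lambda>q. g q $ i $ l) p
         - partial_deriv l (\<lambda>q. g q $ i $ j) p)) / 2"

text \<open>
  A complex geodesic has a complex parameter and may be null, so no normalisation of the velocity
  is required.
\<close>

definition complex_geodesic ::
  "(complex ^ 'n \<Rightarrow> complex ^ 'n ^ 'n) \<Rightarrow> (complex ^ 'n) set \<Rightarrow> complex set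
     \<Rightarrow> (complex \<Rightarrow> complex ^ 'n::finite) \<Rightarrow> bool" where
  "complex_geodesic g M D \<gamma> \<longleftrightarrow>
     open D \<and> connected D \<and> \<gamma> ` D \<subseteq> M \<and>
     (\<forall>k. (\<lambda>u. \<gamma> u $ k) holomorphic_on D) \<and>
     (\<forall>u\<in>D. \<forall>k.
        deriv (deriv (\<lambda>s. \<gamma> s $ k)) u
        + (\<Sum>i\<in>UNIV. \<Sum>j\<in>UNIV. christoffel g k i j (\<gamma> u)
              * deriv (\<lambda>s. \<gamma> s $ i) u * deriv (\<lambda>s. \<gamma> s $ j) u) = 0)"

text \<open>
  The graph of \<open>X\<close> is, near each of its points, a geodesic \<open>u \<mapsto> (\<zeta> u, X (\<zeta> u))\<close> with
  nowhere vanishing derivative of \<open>\<zeta>\<close>.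
\<close>

definition explicit_geodesic ::
  "(complex ^ 2 \<Rightarrow> complex ^ 2 ^ 2) \<Rightarrow> (complex ^ 2) set \<Rightarrow> complex set
     \<Rightarrow> (complex \<Rightarrow> complex) \<Rightarrow> bool" where
  "explicit_geodesic g M S X \<longleftrightarrow>
     (\<forall>z\<^sub>0\<in>S. \<exists>D \<zeta>. 0 \<in> D \<and> \<zeta> 0 = z\<^sub>0 \<and> \<zeta> ` D \<subseteq> S \<and> (\<forall>u\<in>D. deriv \<zeta> u \<noteq> 0) \<and>
        complex_geodesic g M D (\<lambda>u. vector [\<zeta> u, X (\<zeta> u)]))"

text \<open>
  The manifold \<open>M\<^sub>h\<close>: the first coordinate of a point is \<open>z\<close>, the second one is the fibre variable.
\<close>

definition H_carrier :: "complex set \<Rightarrow> (complex \<Rightarrow> complex) \<Rightarrow> (complex ^ 2) set" where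
  "H_carrier U h = {p. p $ 1 \<in> U \<and> p $ 2 \<noteq> 0 \<and> (p $ 2)\<^sup>2 \<noteq> h (p $ 1)}"

definition G_metric :: "(complex \<Rightarrow> complex) \<Rightarrow> complex ^ 2 \<Rightarrow> complex ^ 2 ^ 2" where
  "G_metric h p =
     vector [vector [(h (p $ 1) - (p $ 2)\<^sup>2)\<^sup>2 / (p $ 2)\<^sup>2, 0],
             vector [0, 1 / (p $ 2)\<^sup>2]]"

definition imaginary_unit_sphere :: "(complex ^ 3) set" where
  "imaginary_unit_sphere = {Z. (Z $ 1)\<^sup>2 + (Z $ 2)\<^sup>2 + (Z $ 3)\<^sup>2 = \<i>\<^sup>2}"

text \<open>
  The derivative of \<open>\<Phi>\<close> being multiplication by a complex matrix \<open>J\<close> expresses holomorphy, and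
  \<open>transpose J ** J\<close> is the pullback of the complex bilinear form of \<open>complex ^ 3\<close> (the sum of the
  squares of the coordinate differentials). For a nondegenerate metric the image \<open>\<Phi> ` W\<close> is
  automatically open in the sphere, the dimensions being equal.
\<close>

definition holomorphic_isometry_to_sphere ::
  "(complex ^ 2 \<Rightarrow> complex ^ 2 ^ 2) \<Rightarrow> (complex ^ 2) set \<Rightarrow> (complex ^ 2 \<Rightarrow> complex ^ 3) \<Rightarrow> bool" where
  "holomorphic_isometry_to_sphere g W \<Phi> \<longleftrightarrow>
     inj_on \<Phi> W \<and> \<Phi> ` W \<subseteq> imaginary_unit_sphere \<and>
     (\<forall>p\<in>W. \<exists>J :: complex ^ 2 ^ 3.
        (\<Phi> has_derivative (\<lambda>v. J *v v)) (at p) \<and> transpose J ** J = g p)"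

definition locally_isometric_to_sphere ::
  "(complex ^ 2 \<Rightarrow> complex ^ 2 ^ 2) \<Rightarrow> (complex ^ 2) set \<Rightarrow> bool" where
  "locally_isometric_to_sphere g M \<longleftrightarrow>
     (\<forall>p\<in>M. \<exists>W \<Phi>. open W \<and> p \<in> W \<and> W \<subseteq> M \<and> holomorphic_isometry_to_sphere g W \<Phi>)"

end

theory Submission
  imports Defs
begin

no_notation fps_nth (infixl "$" 75)

text \<open>
  With \<open>\<Theta> = s X\<close> and \<open>s\<^sup>2 = - 1\<close> the Riccati equation becomes \<open>X' = s (h - X\<^sup>2)\<close>, which says that the
  graph of \<open>X\<close> is a null curve of the metric. Differentiating once gives the second order equation;
  a null curve on a surface is a geodesic up to reparametrisation, and an affine parameter is found
  by quadratures. For the isometry with the sphere one linearises: locally \<open>y'' + h y = 0\<close> has two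
  solutions with Wronskian 1, and quadratic expressions in these solutions embed the manifold into
  the sphere. The embedding is locally injective because its Jacobian matrix \<open>J\<close> satisfies
  \<open>transpose J ** J = g\<close> with \<open>g\<close> invertible.
\<close>

section \<open>Local solutions of a second order linear equation by power series\<close>

text \<open>Power series coefficients of the solution of \<open>y'' = - (\<Sum>n. a n * z ^ n) * y\<close>.\<close>

fun ode_coeff :: "(nat \<Rightarrow> complex) \<Rightarrow> complex \<Rightarrow> complex \<Rightarrow> nat \<Rightarrow> complex" where
  "ode_coeff a c\<^sub>0 c\<^sub>1 0 = c\<^sub>0"
| "ode_coeff a c\<^sub>0 c\<^sub>1 (Suc 0) = c\<^sub>1"
| "ode_coeff a c\<^sub>0 c\<^sub>1 (Suc (Suc n)) =
     - (\<Sum>k\<le>n. a k * ode_coeff a c\<^sub>0 c\<^sub>1 (n - k)) / (of_nat (Suc n) * of_nat (Suc (Suc n)))"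

text \<open>Each summand of the convolution is at most \<open>M * C * R ^ m\<close>. There are
  \<open>m + 1\<close> of them, and the factor \<open>m + 1\<close> of the denominator absorbs their
  number. The condition \<open>M \<le> R\<^sup>2\<close> then supplies the two powers of
  \<open>R\<close> by which the index grows.\<close>

lemma norm_ode_coeff_le:
  assumes a: "\<And>n. norm (a n) \<le> M * R ^ n"
    and R: "1 \<le> R" "M \<le> R\<^sup>2" and C: "norm c\<^sub>0 \<le> C" "norm c\<^sub>1 \<le> C"
  shows "norm (ode_coeff a c\<^sub>0 c\<^sub>1 n) \<le> C * R ^ n"
proof (induction n rule: less_induct)
  case (less n)
  have C0: "0 \<le> C"
    using C(1) norm_ge_zero order_trans by blast
  have M0: "0 \<le> M"
    using order_trans[OF norm_ge_zero a[of 0]] by simp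
  consider "n = 0" | "n = 1" | m where "n = Suc (Suc m)"
    by (metis One_nat_def not0_implies_Suc)
  then show ?case
  proof cases
    case 2
    have "C * 1 \<le> C * R"
      using R(1) C0 by (intro mult_left_mono)
    then show ?thesis
      using 2 C(2) by simp
  next
    case 3
    have summand: "norm (a k * ode_coeff a c\<^sub>0 c\<^sub>1 (m - k)) \<le> M * C * R ^ m" if "k \<le> m" for k
    proof -
      have "norm (a k * ode_coeff a c\<^sub>0 c\<^sub>1 (m - k)) \<le> (M * R ^ k) * (C * R ^ (m - k))"
        unfolding norm_mult using 3 M0 R(1) by (intro mult_mono a less.IH) auto
      also have "\<dots> = M * C * R ^ (k + (m - k))"
        by (simp add: power_add)
      finally show ?thesis
        using that by simp
    qed
    have "norm (\<Sum>k\<le>m. a k * ode_coeff a c\<^sub>0 c\<^sub>1 (m - k)) \<le> of_nat (Suc m) * (M * C * R ^ m)"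
      using sum_norm_bound[of "{..m}", OF summand] by simp
    then have "norm (ode_coeff a c\<^sub>0 c\<^sub>1 n)
        \<le> of_nat (Suc m) * (M * C * R ^ m) / (of_nat (Suc m) * of_nat (Suc (Suc m)))"
      unfolding 3 ode_coeff.simps norm_divide norm_minus_cancel norm_mult norm_of_nat
      by (intro divide_right_mono) auto
    also have "\<dots> = M * (C * R ^ m) / of_nat (Suc (Suc m))"
      by (subst mult_divide_mult_cancel_left) auto
    also have "\<dots> \<le> M * (C * R ^ m) / 1"
      using M0 C0 R(1) by (intro divide_left_mono) auto
    also have "\<dots> \<le> R\<^sup>2 * (C * R ^ m)"
      using R C0 by (auto intro!: mult_right_mono)
    also have "\<dots> = C * R ^ n"
      using 3 by (simp add: power2_eq_square)
    finally show ?thesis .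
  qed (use C in auto)
qed

lemma summable_geometric_bound:
  fixes f :: "nat \<Rightarrow> complex"
  assumes "\<And>n. norm (f n) \<le> C * R ^ n" "0 \<le> t" "R * t < 1" "0 < R"
  shows "summable (\<lambda>n. f n * of_real t ^ n)"
proof (rule summable_comparison_test')
  show "summable (\<lambda>n. C * (R * t) ^ n)"
    using assms by (intro summable_mult summable_geometric) auto
  show "norm (f n * of_real t ^ n) \<le> C * (R * t) ^ n" for n
    using mult_right_mono[OF assms(1), of "t ^ n" n] assms(2)
    by (simp add: norm_mult norm_power power_mult_distrib mult.assoc)
qed

text \<open>Power series method: the Taylor coefficients of \<open>h\<close> grow at most
  geometrically, hence so do those of the formal solution, which therefore converges near the
  centre. The derivative is returned as a function \<open>y'\<close> of its own, so the equation
  reads as a first order system. The radius \<open>\<rho>\<close> is cruder than the true one, which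
  suffices for a local statement.\<close>

lemma linear_ode_solution_near_point:
  fixes h :: "complex \<Rightarrow> complex"
  assumes h: "h holomorphic_on ball z\<^sub>0 r" and "0 < r"
  obtains \<rho> y y' where "0 < \<rho>" "\<rho> \<le> r" "y z\<^sub>0 = c\<^sub>0" "y' z\<^sub>0 = c\<^sub>1"
    "\<And>z. z \<in> ball z\<^sub>0 \<rho> \<Longrightarrow> (y has_field_derivative y' z) (at z)"
    "\<And>z. z \<in> ball z\<^sub>0 \<rho> \<Longrightarrow> (y' has_field_derivative - h z * y z) (at z)"
proof -
  define a where "a n = (deriv ^^ n) h z\<^sub>0 / fact n" for n
  have a_sums: "(\<lambda>n. a n * w ^ n) sums h (z\<^sub>0 + w)" if "norm w < r" for w
    using holomorphic_power_series[OF h, of "z\<^sub>0 + w"] that by (simp add: a_def dist_norm)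
  \<comment> \<open>A Cauchy estimate without integrals: the terms of the convergent series at
    \<open>r / 2\<close> tend to 0, hence are bounded by some \<open>M\<close>, and dividing by
    \<open>(r / 2) ^ n\<close> bounds the coefficients.\<close>
  have "(\<lambda>n. a n * of_real (r / 2) ^ n) \<longlonglongrightarrow> 0"
    using a_sums[of "of_real (r / 2)"] \<open>0 < r\<close>
    by (intro summable_LIMSEQ_zero sums_summable[of _ "h (z\<^sub>0 + of_real (r / 2))"]) auto
  then have "Bseq (\<lambda>n. a n * of_real (r / 2) ^ n)"
    by (simp add: convergent_def convergent_imp_Bseq exI[of _ 0])
  then obtain M where M: "0 < M" "\<And>n. norm (a n * of_real (r / 2) ^ n) \<le> M"
    by (auto simp: Bseq_def)
  \<comment> \<open>The three entries of the maximum give the growth rate \<open>2 / r\<close> of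
    the coefficients of \<open>h\<close> and the two inequalities that together yield
    \<open>M \<le> R\<^sup>2\<close>.\<close>
  define R where "R = max (max 1 (2 / r)) M"
  have R: "1 \<le> R" "2 / r \<le> R" "M \<le> R"
    by (auto simp: R_def)
  have "M \<le> R * 1"
    using R(3) by simp
  also have "\<dots> \<le> R\<^sup>2"
    unfolding power2_eq_square using R(1) by (intro mult_left_mono) auto
  finally have "M \<le> R\<^sup>2" .
  have a_le: "norm (a n) \<le> M * R ^ n" for n
  proof -
    have "norm (a n) * (r / 2) ^ n \<le> M"
      using M(2)[of n] \<open>0 < r\<close> by (simp add: norm_mult norm_power norm_divide)
    then have "norm (a n) \<le> M * (2 / r) ^ n"
      using \<open>0 < r\<close> by (simp add: field_simps)
    also have "\<dots> \<le> M * R ^ n"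
      using M(1) R(2) \<open>0 < r\<close> by (intro mult_left_mono power_mono) auto
    finally show ?thesis .
  qed
  define C where "C = max (norm c\<^sub>0) (norm c\<^sub>1)"
  have c_le: "norm (ode_coeff a c\<^sub>0 c\<^sub>1 n) \<le> C * R ^ n" for n
    using a_le R(1) \<open>M \<le> R\<^sup>2\<close> by (rule norm_ode_coeff_le) (auto simp: C_def)
  define H where "H = Abs_fps a"
  define Y where "Y = Abs_fps (ode_coeff a c\<^sub>0 c\<^sub>1)"
  \<comment> \<open>The factor 2 keeps \<open>R * \<rho>\<close> at most 1/2, so the geometric
    majorants converge at \<open>\<rho>\<close> itself.\<close>
  define \<rho> where "\<rho> = min r (1 / (2 * R))"
  have \<rho>: "0 < \<rho>" "\<rho> \<le> r" "R * \<rho> < 1"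
    using R(1) \<open>0 < r\<close> by (auto simp: \<rho>_def min_def field_simps)
  have conv: "ereal (norm w) < fps_conv_radius Y" "ereal (norm w) < fps_conv_radius H"
    if "norm w < \<rho>" for w :: complex
  proof -
    have "ereal (norm (of_real \<rho> :: complex)) \<le> conv_radius (fps_nth Y)"
      using c_le \<rho> R(1)
      by (intro conv_radius_geI summable_geometric_bound[of _ C R]) (auto simp: Y_def)
    moreover have "ereal (norm (of_real \<rho> :: complex)) \<le> conv_radius (fps_nth H)"
      using a_le \<rho> R(1)
      by (intro conv_radius_geI summable_geometric_bound[of _ M R]) (auto simp: H_def)
    ultimately show "ereal (norm w) < fps_conv_radius Y" "ereal (norm w) < fps_conv_radius H"
      using that \<rho>(1) by (auto simp: fps_conv_radius_def elim: less_le_trans[rotated])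
  qed
  have eval_H: "eval_fps H w = h (z\<^sub>0 + w)" if "norm w < \<rho>" for w
    using sums_unique[OF a_sums[of w]] that \<rho>(2) by (simp add: H_def eval_fps_def)
  \<comment> \<open>The recursion of \<open>ode_coeff\<close> is this identity of formal power
    series, read off coefficient by coefficient.\<close>
  have ode: "fps_deriv (fps_deriv Y) = - (H * Y)"
  proof (rule fps_ext)
    fix n
    have "fps_nth (fps_deriv (fps_deriv Y)) n
        = of_nat (Suc n) * of_nat (Suc (Suc n)) * ode_coeff a c\<^sub>0 c\<^sub>1 (Suc (Suc n))"
      by (simp add: Y_def del: of_nat_Suc ode_coeff.simps)
    also have "\<dots> = - (\<Sum>k\<le>n. a k * ode_coeff a c\<^sub>0 c\<^sub>1 (n - k))"
      by (simp del: of_nat_Suc)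
    finally show "fps_nth (fps_deriv (fps_deriv Y)) n = fps_nth (- (H * Y)) n"
      by (simp add: Y_def H_def fps_mult_nth atLeast0AtMost)
  qed
  define y where "y z = eval_fps Y (z - z\<^sub>0)" for z
  define y' where "y' z = eval_fps (fps_deriv Y) (z - z\<^sub>0)" for z
  show ?thesis
  proof
    show "y z\<^sub>0 = c\<^sub>0" "y' z\<^sub>0 = c\<^sub>1"
      by (simp_all add: y_def y'_def eval_fps_at_0 Y_def)
  next
    fix z assume "z \<in> ball z\<^sub>0 \<rho>"
    then have w: "norm (z - z\<^sub>0) < \<rho>"
      by (simp add: dist_norm norm_minus_commute)
    note Y = conv(1)[OF w] and H = conv(2)[OF w]
    have Y': "ereal (norm (z - z\<^sub>0)) < fps_conv_radius (fps_deriv Y)"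
      using Y fps_conv_radius_deriv[of Y] by (rule less_le_trans)
    have shift: "((\<lambda>u. eval_fps f (u - z\<^sub>0)) has_field_derivative eval_fps (fps_deriv f) (z - z\<^sub>0)) (at z)"
      if "ereal (norm (z - z\<^sub>0)) < fps_conv_radius f" for f
    proof -
      have "((\<lambda>u. u - z\<^sub>0) has_field_derivative 1) (at z)"
        by (auto intro!: derivative_eq_intros)
      from DERIV_chain2[of "eval_fps f" _ "\<lambda>u. u - z\<^sub>0", OF has_field_derivative_eval_fps[OF that] this]
      show ?thesis
        by simp
    qed
    show "(y has_field_derivative y' z) (at z)"
      unfolding y_def y'_def using Y by (rule shift)
    have "eval_fps (fps_deriv (fps_deriv Y)) (z - z\<^sub>0) = - h z * y z"
      using eval_fps_mult[OF H Y] eval_H[OF w] less_le_trans[OF _ fps_conv_radius_mult, of _ H Y] Y H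
      by (simp add: ode eval_fps_minus y_def)
    then show "(y' has_field_derivative - h z * y z) (at z)"
      unfolding y'_def using shift[OF Y'] by simp
  qed (use \<rho> in auto)
qed

section \<open>Matrix derivatives and local injectivity\<close>

text \<open>Limits of vectors are coordinatewise. Here the coordinates are complex entries, not
  components along a real basis.\<close>

lemma has_derivative_matrixI:
  fixes f :: "complex ^ 'n \<Rightarrow> complex ^ 'm"
  assumes "\<And>k. ((\<lambda>x. f x $ k) has_derivative (\<lambda>v. (J *v v) $ k)) (at p)"
  shows "(f has_derivative (\<lambda>v. J *v v)) (at p)"
  unfolding has_derivative_within
proof (intro conjI vec_tendstoI)
  show "((\<lambda>y. ((1 / norm (y - p)) *\<^sub>R (f y - (f p + J *v (y - p)))) $ k) \<longlongrightarrow> 0 $ k) (at p)" for k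
    using assms[of k] by (simp add: has_derivative_within)
qed simp

text \<open>A left inverse of the derivative at \<open>a\<close>, together with derivatives close to
  it in operator norm nearby, forces injectivity. This covers maps into a space of larger dimension,
  such as the embedding of a surface.\<close>

lemma locally_injective_of_matrix_derivative:
  fixes \<Phi> :: "complex ^ 'n \<Rightarrow> complex ^ 'm" and J :: "complex ^ 'n \<Rightarrow> complex ^ 'n ^ 'm"
  assumes "open S" "a \<in> S"
    and der: "\<And>p. p \<in> S \<Longrightarrow> (\<Phi> has_derivative (\<lambda>v. J p *v v)) (at p)"
    and cont: "\<And>i j. continuous (at a) (\<lambda>p. J p $ i $ j)"
    and inv: "B ** J a = mat 1"
  obtains r where "0 < r" "ball a r \<subseteq> S" "inj_on \<Phi> (ball a r)"
proof (rule has_derivative_locally_injective[of a S "(*v) B" "\<lambda>p v. J p *v v" \<Phi>])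
  show "(*v) B \<circ> (*v) (J a) = id"
    by (auto simp: fun_eq_iff matrix_vector_mul_assoc inv)
next
  fix e :: real assume "0 < e"
  \<comment> \<open>The sum of the entrywise distances dominates the operator norm of the difference
    of the matrices and tends to 0 by continuity of the entries.\<close>
  define N where "N p = (\<Sum>i\<in>UNIV. \<Sum>j\<in>UNIV. norm (J p $ i $ j - J a $ i $ j))" for p
  have "(N \<longlongrightarrow> (\<Sum>i\<in>(UNIV :: 'm set). \<Sum>j\<in>(UNIV :: 'n set). 0)) (at a)"
    unfolding N_def using cont
    by (intro tendsto_sum tendsto_norm_zero LIM_zero) (simp add: continuous_at)
  then have "\<forall>\<^sub>F p in at a. N p < e"
    using \<open>0 < e\<close> by (intro order_tendstoD(2)) auto
  moreover have "N a < e"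
    using \<open>0 < e\<close> by (simp add: N_def)
  ultimately obtain d where "0 < d" and d: "\<And>p. dist p a < d \<Longrightarrow> N p < e"
    unfolding eventually_at by (metis UNIV_I)
  have onorm_le: "onorm (\<lambda>v. J p *v v - J a *v v) \<le> N p" for p
  proof (rule onorm_bound)
    fix v
    have "norm (J p *v v - J a *v v) \<le> (\<Sum>i\<in>UNIV. norm ((J p *v v - J a *v v) $ i))"
      unfolding norm_vec_def by (rule L2_set_le_sum) simp
    also have "\<dots> \<le> (\<Sum>i\<in>UNIV. \<Sum>j\<in>UNIV. norm (J p $ i $ j - J a $ i $ j) * norm v)"
    proof (intro sum_mono)
      fix i
      have "(J p *v v - J a *v v) $ i = (\<Sum>j\<in>UNIV. (J p $ i $ j - J a $ i $ j) * v $ j)"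
        by (simp add: matrix_vector_mult_def sum_subtractf left_diff_distrib)
      also have "norm \<dots> \<le> (\<Sum>j\<in>UNIV. norm (J p $ i $ j - J a $ i $ j) * norm v)"
        by (intro sum_norm_le)
          (auto simp: norm_mult intro!: mult_left_mono Finite_Cartesian_Product.norm_nth_le)
      finally show "norm ((J p *v v - J a *v v) $ i)
          \<le> (\<Sum>j\<in>UNIV. norm (J p $ i $ j - J a $ i $ j) * norm v)" .
    qed
    finally show "norm (J p *v v - J a *v v) \<le> N p * norm v"
      by (simp add: N_def sum_distrib_right)
  qed (auto simp: N_def intro!: sum_nonneg)
  show "\<exists>d>0. \<forall>p. dist a p < d \<longrightarrow> onorm (\<lambda>v. J p *v v - J a *v v) < e"
  proof (intro exI[of _ d] conjI allI impI)
    fix p assume "dist a p < d"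
    then have "N p < e"
      by (intro d) (simp add: dist_commute)
    with onorm_le[of p]
    show "onorm (\<lambda>v. J p *v v - J a *v v) < e"
      by (rule le_less_trans)
  qed (fact \<open>0 < d\<close>)
qed (rule assms(1,2) matrix_vector_mul_bounded_linear der that | assumption)+

section \<open>Inverse metric and Christoffel symbols\<close>

text \<open>Since \<open>matrix_inv\<close> is a choice among inverses, the explicit formula follows
  from exhibiting a two-sided inverse and using uniqueness.\<close>

lemma matrix_inv_G_metric:
  assumes "p $ 2 \<noteq> 0" "(p $ 2)\<^sup>2 \<noteq> h (p $ 1)"
  shows "matrix_inv (G_metric h p) ** G_metric h p = mat 1" (is ?inv)
    and "matrix_inv (G_metric h p) =
      vector [vector [(p $ 2)\<^sup>2 / (h (p $ 1) - (p $ 2)\<^sup>2)\<^sup>2, 0], vector [0, (p $ 2)\<^sup>2]]"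
      (is "_ = ?B")
proof -
  have "h (p $ 1) - (p $ 2)\<^sup>2 \<noteq> 0"
    using assms(2) by simp
  then have "G_metric h p ** ?B = mat 1" "?B ** G_metric h p = mat 1"
    using assms(1)
    by (simp_all add: vec_eq_iff forall_2 matrix_matrix_mult_def sum_2 mat_def G_metric_def)
  then have "G_metric h p ** matrix_inv (G_metric h p) = mat 1 \<and> ?inv"
    unfolding matrix_inv_def by (intro someI conjI)
  then show ?inv ..
  have "matrix_inv (G_metric h p) = matrix_inv (G_metric h p) ** (G_metric h p ** ?B)"
    by (simp add: \<open>G_metric h p ** ?B = mat 1\<close>)
  also have "\<dots> = matrix_inv (G_metric h p) ** G_metric h p ** ?B"
    by (rule matrix_mul_assoc)
  also have "\<dots> = ?B"
    using \<open>?inv\<close> by simp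
  finally show "matrix_inv (G_metric h p) = ?B" .
qed

lemma partial_deriv_G_metric:
  assumes h: "(h has_field_derivative h') (at (p $ 1))" and x: "p $ 2 \<noteq> 0"
  shows "partial_deriv 1 (\<lambda>q. G_metric h q $ 1 $ 1) p
      = 2 * (h (p $ 1) - (p $ 2)\<^sup>2) * h' / (p $ 2)\<^sup>2"
    and "partial_deriv 2 (\<lambda>q. G_metric h q $ 1 $ 1) p
      = - 2 * (h (p $ 1) - (p $ 2)\<^sup>2) * (h (p $ 1) + (p $ 2)\<^sup>2) / (p $ 2) ^ 3"
    and "partial_deriv 1 (\<lambda>q. G_metric h q $ 2 $ 2) p = 0"
    and "partial_deriv 2 (\<lambda>q. G_metric h q $ 2 $ 2) p = - 2 / (p $ 2) ^ 3"
    and "partial_deriv k (\<lambda>q. G_metric h q $ 1 $ 2) p = 0"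
    and "partial_deriv k (\<lambda>q. G_metric h q $ 2 $ 1) p = 0"
proof -
  have "((\<lambda>t. (h t - (p $ 2)\<^sup>2)\<^sup>2 / (p $ 2)\<^sup>2) has_field_derivative
      2 * (h (p $ 1) - (p $ 2)\<^sup>2) * h' / (p $ 2)\<^sup>2) (at (p $ 1))"
    by (rule derivative_eq_intros refl h)+ (use x in \<open>auto simp: field_simps eval_nat_numeral\<close>)
  from DERIV_imp_deriv[OF this]
  show "partial_deriv 1 (\<lambda>q. G_metric h q $ 1 $ 1) p
      = 2 * (h (p $ 1) - (p $ 2)\<^sup>2) * h' / (p $ 2)\<^sup>2"
    by (simp add: partial_deriv_def G_metric_def)
  have "((\<lambda>t. (h (p $ 1) - t\<^sup>2)\<^sup>2 / t\<^sup>2) has_field_derivative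
      - 2 * (h (p $ 1) - (p $ 2)\<^sup>2) * (h (p $ 1) + (p $ 2)\<^sup>2) / (p $ 2) ^ 3) (at (p $ 2))"
    by (rule derivative_eq_intros refl)+ (use x in \<open>auto simp: field_simps eval_nat_numeral\<close>)
  from DERIV_imp_deriv[OF this]
  show "partial_deriv 2 (\<lambda>q. G_metric h q $ 1 $ 1) p
      = - 2 * (h (p $ 1) - (p $ 2)\<^sup>2) * (h (p $ 1) + (p $ 2)\<^sup>2) / (p $ 2) ^ 3"
    by (simp add: partial_deriv_def G_metric_def)
  have "((\<lambda>t. 1 / t\<^sup>2) has_field_derivative - 2 / (p $ 2) ^ 3) (at (p $ 2))"
    by (rule derivative_eq_intros refl)+ (use x in \<open>auto simp: field_simps eval_nat_numeral\<close>)
  from DERIV_imp_deriv[OF this]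
  show "partial_deriv 2 (\<lambda>q. G_metric h q $ 2 $ 2) p = - 2 / (p $ 2) ^ 3"
    by (simp add: partial_deriv_def G_metric_def)
qed (simp_all add: partial_deriv_def G_metric_def)

lemma christoffel_G_metric:
  assumes h: "(h has_field_derivative h') (at (p $ 1))"
    and x: "p $ 2 \<noteq> 0" "(p $ 2)\<^sup>2 \<noteq> h (p $ 1)"
  defines "f \<equiv> h (p $ 1) - (p $ 2)\<^sup>2"
  shows "christoffel (G_metric h) 1 1 1 p = h' / f"
    and "christoffel (G_metric h) 1 1 2 p = - 2 * p $ 2 / f - 1 / p $ 2"
    and "christoffel (G_metric h) 1 2 1 p = - 2 * p $ 2 / f - 1 / p $ 2"
    and "christoffel (G_metric h) 1 2 2 p = 0"
    and "christoffel (G_metric h) 2 1 1 p = 2 * p $ 2 * f + f\<^sup>2 / p $ 2"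
    and "christoffel (G_metric h) 2 1 2 p = 0"
    and "christoffel (G_metric h) 2 2 1 p = 0"
    and "christoffel (G_metric h) 2 2 2 p = - 1 / p $ 2"
proof -
  \<comment> \<open>With \<open>h\<close> eliminated in favour of \<open>f\<close>, the denominators
    are products of powers of \<open>f\<close> and of the fibre coordinate, both nonzero.\<close>
  have "f \<noteq> 0" and hp: "h (p $ 1) = f + (p $ 2)\<^sup>2"
    using x(2) by (auto simp: f_def)
  then show "christoffel (G_metric h) 1 1 1 p = h' / f"
    and "christoffel (G_metric h) 1 1 2 p = - 2 * p $ 2 / f - 1 / p $ 2"
    and "christoffel (G_metric h) 1 2 1 p = - 2 * p $ 2 / f - 1 / p $ 2"
    and "christoffel (G_metric h) 1 2 2 p = 0"
    and "christoffel (G_metric h) 2 1 1 p = 2 * p $ 2 * f + f\<^sup>2 / p $ 2"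
    and "christoffel (G_metric h) 2 1 2 p = 0"
    and "christoffel (G_metric h) 2 2 1 p = 0"
    and "christoffel (G_metric h) 2 2 2 p = - 1 / p $ 2"
    using x(1)
    unfolding christoffel_def sum_2 matrix_inv_G_metric(2)[of p h, OF x] partial_deriv_G_metric[of h h' p, OF h x(1)]
    by (simp_all add: hp field_simps power2_eq_square power3_eq_cube)
qed

section \<open>Null graphs as geodesics\<close>

text \<open>The \<open>z\<close> component of the geodesic equation for velocity
  \<open>(v, s * f * v)\<close>, where \<open>f\<close> stands for \<open>h - X\<^sup>2\<close> and
  \<open>d\<close> for \<open>h'\<close>. The first bracket is the value of \<open>\<zeta>''\<close>
  that makes it hold.\<close>

lemma geodesic_eq_base:
  fixes x f d s v :: complex
  assumes "x \<noteq> 0" "f \<noteq> 0" 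
  shows "(- d / f + 4 * s * x + 2 * s * f / x) * v\<^sup>2 + (d / f * v * v
          + (- 2 * x / f - 1 / x) * v * (s * f * v)
          + (- 2 * x / f - 1 / x) * (s * f * v) * v) = 0"
  using assms by (simp add: field_simps power2_eq_square)

text \<open>The fibre component for the same velocity and the same \<open>\<zeta>''\<close>. The
  condition on \<open>s\<close>, nullity of the velocity, makes the remaining terms cancel.\<close>

lemma geodesic_eq_fibre:
  fixes x f d s v :: complex
  assumes "x \<noteq> 0" "f \<noteq> 0" "s\<^sup>2 = -1"
  shows "s * (d - 2 * x * s * f) * v\<^sup>2 + s * f * ((- d / f + 4 * s * x + 2 * s * f / x) * v\<^sup>2)
          + ((2 * x * f + f\<^sup>2 / x) * v * v + - 1 / x * (s * f * v) * (s * f * v)) = 0" 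
proof -
  have e: "s * f * ((- d / f + 4 * s * x + 2 * s * f / x) * v\<^sup>2)
      = (- s * d + s\<^sup>2 * (4 * x * f + 2 * f\<^sup>2 / x)) * v\<^sup>2"
    using assms(1,2) by (simp add: field_simps power2_eq_square)
  have e': "s * (d - 2 * x * s * f) = s * d - s\<^sup>2 * (2 * x * f)" 
      "- 1 / x * (s * f * v) * (s * f * v) = - s\<^sup>2 * (f\<^sup>2 / x * v\<^sup>2)"
    by (simp_all add: algebra_simps power2_eq_square)
  show ?thesis
    unfolding e e' unfolding assms(3) by (simp add: algebra_simps power2_eq_square)
qed
text \<open>Along the graph both geodesic equations reduce to one scalar equation for the base
  coordinate \<open>\<zeta>\<close>, so it is enough to find an affine parameter locally.\<close>

lemma graph_explicit_geodesic:
  fixes h X :: "complex \<Rightarrow> complex" and s :: complex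
  assumes "open S" and h: "h holomorphic_on S" and X: "X holomorphic_on S"
    and X0: "\<And>z. z \<in> S \<Longrightarrow> X z \<noteq> 0" and hX: "\<And>z. z \<in> S \<Longrightarrow> h z \<noteq> (X z)\<^sup>2"
    and s: "s\<^sup>2 = -1" and dX: "\<And>z. z \<in> S \<Longrightarrow> deriv X z = s * (h z - (X z)\<^sup>2)"
    and "S \<subseteq> U"
  shows "explicit_geodesic (G_metric h) (H_carrier U h) S X"
  unfolding explicit_geodesic_def
proof
  fix z\<^sub>0 assume "z\<^sub>0 \<in> S"
  with \<open>open S\<close> obtain r where r: "0 < r" "ball z\<^sub>0 r \<subseteq> S"
    by (meson open_contains_ball)
  define F where "F z = h z - (X z)\<^sup>2" for z
  have F0: "F z \<noteq> 0" if "z \<in> S" for z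
    using hX[OF that] by (simp add: F_def)
  \<comment> \<open>The first geodesic equation reads \<open>\<zeta>'' = A(\<zeta>) \<zeta>'\<^sup>2\<close>. It is solved by quadratures: with
    \<open>P' = A\<close>, the parameter as a function of \<open>z\<close> is a primitive of \<open>exp (- P)\<close>.\<close>
  define A where "A z = - deriv h z / F z + 4 * s * X z + 2 * s * F z / X z" for z
  have "A holomorphic_on S"
    unfolding A_def F_def using X0 hX \<open>open S\<close> h X by (intro holomorphic_intros) auto
  then have "A holomorphic_on ball z\<^sub>0 r"
    using r(2) by (rule holomorphic_on_subset)
  then obtain P where P: "\<And>z. z \<in> ball z\<^sub>0 r \<Longrightarrow> (P has_field_derivative A z) (at z)"
    using holomorphic_convex_primitive'[of "ball z\<^sub>0 r" A] by (metis convex_ball open_ball at_within_open)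
  then have "P holomorphic_on ball z\<^sub>0 r"
    unfolding holomorphic_on_open[OF open_ball] by blast
  then have "(\<lambda>z. exp (- P z)) holomorphic_on ball z\<^sub>0 r"
    by (intro holomorphic_intros)
  then obtain Q where Q: "\<And>z. z \<in> ball z\<^sub>0 r \<Longrightarrow> (Q has_field_derivative exp (- P z)) (at z)"
    using holomorphic_convex_primitive'[of "ball z\<^sub>0 r" "\<lambda>z. exp (- P z)"]
    by (metis convex_ball open_ball at_within_open)
  \<comment> \<open>Subtracting the value at the base point makes parameter 0 correspond to
    \<open>z\<^sub>0\<close>.\<close>
  define G where "G z = Q z - Q z\<^sub>0" for z
  have G: "(G has_field_derivative exp (- P z)) (at z)" if "z \<in> ball z\<^sub>0 r" for z
    unfolding G_def using Q[OF that] by (auto intro!: derivative_eq_intros)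
  then have G_hol: "G holomorphic_on ball z\<^sub>0 r"
    unfolding holomorphic_on_open[OF open_ball] by blast
  have "deriv G z\<^sub>0 \<noteq> 0"
    using DERIV_imp_deriv[OF G[of z\<^sub>0]] r(1) by simp
  \<comment> \<open>\<open>G\<close> gives the parameter as a function of \<open>z\<close>; the
    geodesic is its local inverse, defined on the image of this ball.\<close>
  then obtain t where t: "0 < t" "ball z\<^sub>0 t \<subseteq> ball z\<^sub>0 r" "open (G ` ball z\<^sub>0 t)" "inj_on G (ball z\<^sub>0 t)"
    using has_complex_derivative_locally_invertible[OF G_hol] r(1) by (metis centre_in_ball open_ball)
  define D where "D = G ` ball z\<^sub>0 t"
  have G_hol': "G holomorphic_on ball z\<^sub>0 t"
    using G_hol t(2) by (rule holomorphic_on_subset)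
  then obtain \<zeta> where \<zeta>_hol: "\<zeta> holomorphic_on D"
    and \<zeta>': "\<And>z. z \<in> ball z\<^sub>0 t \<Longrightarrow> deriv G z * deriv \<zeta> (G z) = 1"
    and \<zeta>: "\<And>z. z \<in> ball z\<^sub>0 t \<Longrightarrow> \<zeta> (G z) = z"
    using holomorphic_has_inverse[OF G_hol' open_ball t(4)] unfolding D_def by metis
  have "open D" "connected D"
    using t(3) G_hol' by (auto simp: D_def intro!: connected_continuous_image holomorphic_on_imp_continuous_on)
  have \<zeta>_ball: "\<zeta> u \<in> ball z\<^sub>0 r" if "u \<in> D" for u
    using that \<zeta> t(2) by (auto simp: D_def)
  then have \<zeta>_S: "\<zeta> u \<in> S" if "u \<in> D" for u
    using that r(2) by blast
  have d\<zeta>_eq: "deriv \<zeta> u = exp (P (\<zeta> u))" if u: "u \<in> D" for u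
  proof -
    obtain z where z: "z \<in> ball z\<^sub>0 t" "u = G z"
      using u by (auto simp: D_def)
    then have "exp (- P z) * deriv \<zeta> u = 1"
      using \<zeta>'[of z] DERIV_imp_deriv[OF G[of z]] t(2) by auto
    then show ?thesis
      using z \<zeta>[of z] by (simp add: exp_minus field_simps)
  qed
  have d\<zeta>: "(\<zeta> has_field_derivative deriv \<zeta> u) (at u)" if "u \<in> D" for u
    using holomorphic_derivI[OF \<zeta>_hol \<open>open D\<close> that] .
  \<comment> \<open>Differentiating \<open>\<zeta>' = exp (P \<zeta>)\<close> produces
    \<open>A(\<zeta>)\<close> times \<open>\<zeta>'\<close> times the same exponential, which is
    again \<open>\<zeta>'\<close>.\<close>
  have d2\<zeta>: "(deriv \<zeta> has_field_derivative A (\<zeta> u) * (deriv \<zeta> u)\<^sup>2) (at u)" if u: "u \<in> D" for u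
  proof (rule has_field_derivative_transform_within_open[OF _ \<open>open D\<close> u])
    show "((\<lambda>u. exp (P (\<zeta> u))) has_field_derivative A (\<zeta> u) * (deriv \<zeta> u)\<^sup>2) (at u)"
      using DERIV_fun_exp[OF DERIV_chain2[OF P[OF \<zeta>_ball[OF u]] d\<zeta>[OF u]]]
      by (simp add: d\<zeta>_eq[OF u] power2_eq_square mult_ac)
  qed (simp add: d\<zeta>_eq)
  have X\<zeta>: "((\<lambda>u. X (\<zeta> u)) has_field_derivative s * F (\<zeta> u) * deriv \<zeta> u) (at u)" if u: "u \<in> D" for u
    using DERIV_chain2[OF holomorphic_derivI[OF X \<open>open S\<close> \<zeta>_S[OF u]] d\<zeta>[OF u]]
    by (simp add: dX[OF \<zeta>_S[OF u]] F_def)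
  have dh: "(h has_field_derivative deriv h (\<zeta> u)) (at (\<zeta> u))" if "u \<in> D" for u
    using holomorphic_derivI[OF h \<open>open S\<close> \<zeta>_S[OF that]] .
  \<comment> \<open>Product rule for \<open>s * F(\<zeta>) * \<zeta>'\<close>, with
    \<open>F' = h' - 2 * X * s * F\<close> along the graph.\<close>
  have d2X\<zeta>: "(deriv (\<lambda>u. X (\<zeta> u)) has_field_derivative
      s * (deriv h (\<zeta> u) - 2 * X (\<zeta> u) * s * F (\<zeta> u)) * (deriv \<zeta> u)\<^sup>2
      + s * F (\<zeta> u) * (A (\<zeta> u) * (deriv \<zeta> u)\<^sup>2)) (at u)" if u: "u \<in> D" for u
  proof (rule has_field_derivative_transform_within_open[OF _ \<open>open D\<close> u])
    show "((\<lambda>u. s * F (\<zeta> u) * deriv \<zeta> u) has_field_derivative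
      s * (deriv h (\<zeta> u) - 2 * X (\<zeta> u) * s * F (\<zeta> u)) * (deriv \<zeta> u)\<^sup>2
      + s * F (\<zeta> u) * (A (\<zeta> u) * (deriv \<zeta> u)\<^sup>2)) (at u)"
      unfolding F_def[abs_def]
      by (rule DERIV_cong[OF DERIV_mult[OF DERIV_cmult[OF DERIV_diff[OF
                DERIV_chain2[OF dh[OF u] d\<zeta>[OF u]] DERIV_power[OF X\<zeta>[OF u]]]] d2\<zeta>[OF u]]])
        (simp add: F_def algebra_simps power2_eq_square)
  qed (rule DERIV_imp_deriv[OF X\<zeta>, symmetric])
  have geodesic: "complex_geodesic (G_metric h) (H_carrier U h) D (\<lambda>u. vector [\<zeta> u, X (\<zeta> u)])"
    unfolding complex_geodesic_def
  proof (intro conjI ballI)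
    show "(\<lambda>u. vector [\<zeta> u, X (\<zeta> u)]) ` D \<subseteq> H_carrier U h"
    proof (intro image_subsetI)
      fix u assume "u \<in> D"
      from \<zeta>_S[OF this] show "vector [\<zeta> u, X (\<zeta> u)] \<in> H_carrier U h"
        using X0 hX \<open>S \<subseteq> U\<close> by (auto simp: H_carrier_def dest: sym)
    qed
    have "(\<lambda>u. X (\<zeta> u)) holomorphic_on D"
      unfolding holomorphic_on_open[OF \<open>open D\<close>] using X\<zeta> by blast
    then show "\<forall>k. (\<lambda>u. (vector [\<zeta> u, X (\<zeta> u)] :: complex ^ 2) $ k) holomorphic_on D"
      using \<zeta>_hol by (simp add: forall_2)
  next
    fix u assume u: "u \<in> D"
    define p :: "complex ^ 2" where "p = vector [\<zeta> u, X (\<zeta> u)]"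
    have p: "p $ 1 = \<zeta> u" "p $ 2 = X (\<zeta> u)"
      by (simp_all add: p_def)
    have x0: "X (\<zeta> u) \<noteq> 0" and f0: "F (\<zeta> u) \<noteq> 0"
      using X0 F0 \<zeta>_S[OF u] by auto
    have "(h has_field_derivative deriv h (\<zeta> u)) (at (p $ 1))" "p $ 2 \<noteq> 0" "(p $ 2)\<^sup>2 \<noteq> h (p $ 1)"
      using dh[OF u] x0 hX[OF \<zeta>_S[OF u]] by (simp_all add: p)
    note \<Gamma> = christoffel_G_metric[OF this, unfolded p, folded F_def]
    note base = geodesic_eq_base[OF x0 f0, of "deriv h (\<zeta> u)" s "deriv \<zeta> u", folded A_def]
    note fibre = geodesic_eq_fibre[OF x0 f0 s, of "deriv h (\<zeta> u)" "deriv \<zeta> u", folded A_def]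
    show "\<forall>k. deriv (deriv (\<lambda>s. vector [\<zeta> s, X (\<zeta> s)] $ k)) u
        + (\<Sum>i\<in>UNIV. \<Sum>j\<in>UNIV. christoffel (G_metric h) k i j (vector [\<zeta> u, X (\<zeta> u)])
            * deriv (\<lambda>s. vector [\<zeta> s, X (\<zeta> s)] $ i) u
            * deriv (\<lambda>s. vector [\<zeta> s, X (\<zeta> s)] $ j) u) = 0"
      unfolding forall_2 sum_2 vector_2 p_def[symmetric] \<Gamma>
        DERIV_imp_deriv[OF d2\<zeta>[OF u]]
          DERIV_imp_deriv[OF d2X\<zeta>[OF u]] DERIV_imp_deriv[OF X\<zeta>[OF u]]
      using base fibre by (simp only: mult_zero_left add_0_left add_0_right add.assoc simp_thms)
  qed fact+
  show "\<exists>D \<zeta>. 0 \<in> D \<and> \<zeta> 0 = z\<^sub>0 \<and> \<zeta> ` D \<subseteq> S \<and> (\<forall>u\<in>D. deriv \<zeta> u \<noteq> 0) \<and>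
      complex_geodesic (G_metric h) (H_carrier U h) D (\<lambda>u. vector [\<zeta> u, X (\<zeta> u)])"
  proof (intro exI conjI)
    have "G z\<^sub>0 = 0"
      by (simp add: G_def)
    then show "0 \<in> D" "\<zeta> 0 = z\<^sub>0"
      using \<zeta>[of z\<^sub>0] t(1) by (auto simp: D_def intro!: image_eqI[of _ _ z\<^sub>0])
  qed (use \<zeta>_S d\<zeta>_eq in \<open>auto intro: geodesic\<close>)
qed

section \<open>The second order equation\<close>

text \<open>Here \<open>D\<close> stands for \<open>X\<^sup>2 - h\<close>, so that
  \<open>X' = - s * D\<close>. The left side is the derivative of
  \<open>s * (h - X\<^sup>2)\<close>, the right side the claimed expression with \<open>h\<close>
  replaced by \<open>x\<^sup>2 - D\<close>.\<close>

lemma riccati_second_derivative_identity: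
  fixes x D s h' :: complex
  assumes "x \<noteq> 0" "D \<noteq> 0" "s\<^sup>2 = -1"
  shows "s * (h' + 2 * x * s * D) = (3 * x\<^sup>2 + (x\<^sup>2 - D)) / D * ((- s * D)\<^sup>2 / x) - h' * (- s * D) / D
     + (x ^ 4 - (x\<^sup>2 - D)\<^sup>2) / x"
proof -
  have e: "s * (h' + 2 * x * s * D) = s * h' + s\<^sup>2 * (2 * x * D)" "(- s * D)\<^sup>2 = s\<^sup>2 * D\<^sup>2" 
    by (simp_all add: algebra_simps power2_eq_square)
  show ?thesis
    unfolding e unfolding assms(3) using assms(1,2) by (simp add: field_simps power2_eq_square power4_eq_xxxx)
qed

lemma riccati_second_derivative:
  fixes h X :: "complex \<Rightarrow> complex" and s :: complex
  assumes "open S" and h: "h holomorphic_on S" and X: "X holomorphic_on S"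
    and s: "s\<^sup>2 = -1" and dX: "\<And>z. z \<in> S \<Longrightarrow> deriv X z = s * (h z - (X z)\<^sup>2)"
    and z: "z \<in> S" "X z \<noteq> 0" "h z \<noteq> (X z)\<^sup>2"
  shows "deriv (deriv X) z =
            (3 * (X z)\<^sup>2 + h z) / ((X z)\<^sup>2 - h z) * ((deriv X z)\<^sup>2 / X z)
            - deriv h z * deriv X z / ((X z)\<^sup>2 - h z)
            + ((X z) ^ 4 - (h z)\<^sup>2) / X z"
proof -
  define D where "D = (X z)\<^sup>2 - h z"
  have D: "D \<noteq> 0" "h z = (X z)\<^sup>2 - D" and X': "deriv X z = - s * D"
    using z dX by (auto simp: D_def algebra_simps)
  have "(deriv X has_field_derivative s * (deriv h z - 2 * X z * deriv X z)) (at z)"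
  proof (rule has_field_derivative_transform_within_open[OF _ \<open>open S\<close> z(1)])
    show "((\<lambda>z. s * (h z - (X z)\<^sup>2)) has_field_derivative s * (deriv h z - 2 * X z * deriv X z)) (at z)"
      by (rule DERIV_cong[OF DERIV_cmult[OF DERIV_diff[OF holomorphic_derivI[OF h \<open>open S\<close> z(1)]
              DERIV_power[OF holomorphic_derivI[OF X \<open>open S\<close> z(1)]]]]]) simp
  qed (simp add: dX)
  then have "deriv (deriv X) z = s * (deriv h z + 2 * X z * s * D)"
    by (simp add: DERIV_imp_deriv X')
  also have "\<dots> = (3 * (X z)\<^sup>2 + h z) / D * ((deriv X z)\<^sup>2 / X z)
      - deriv h z * deriv X z / D + ((X z) ^ 4 - (h z)\<^sup>2) / X z"
    unfolding X' D(2) using z(2) D(1) s by (rule riccati_second_derivative_identity)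
  finally show ?thesis
    unfolding D_def .
qed

section \<open>Local isometry with the sphere\<close>

text \<open>
  If \<open>y\<close>, \<open>w\<close> solve \<open>y'' = - h y\<close> with Wronskian 1, then \<open>Q(y, w) = y' w' / x + x y w\<close> satisfies
  \<open>Q(y, w)\<^sup>2 - Q(y, y) Q(w, w) = - 1\<close>, and \<open>dQ(y, w)\<^sup>2 - dQ(y, y) dQ(w, w)\<close> is the metric.
\<close>

definition solution_form ::
  "(complex \<Rightarrow> complex) \<Rightarrow> (complex \<Rightarrow> complex) \<Rightarrow> (complex \<Rightarrow> complex) \<Rightarrow> (complex \<Rightarrow> complex)
     \<Rightarrow> complex ^ 2 \<Rightarrow> complex" where
  "solution_form y y' w w' p = y' (p $ 1) * w' (p $ 1) / p $ 2 + p $ 2 * (y (p $ 1) * w (p $ 1))"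

text \<open>This and \<open>solution_form_dx\<close> are the two partial derivatives of
  \<open>solution_form\<close>, with second derivatives eliminated through
  \<open>y'' = - h * y\<close>. That elimination produces the common factor
  \<open>x - h / x\<close>.\<close>

definition solution_form_dz where
  "solution_form_dz h y y' w w' p =
     (p $ 2 - h (p $ 1) / p $ 2) * (y (p $ 1) * w' (p $ 1) + y' (p $ 1) * w (p $ 1))"
  for p :: "complex ^ 2" and h y y' w w' :: "complex \<Rightarrow> complex"

definition solution_form_dx where
  "solution_form_dx y y' w w' p = y (p $ 1) * w (p $ 1) - y' (p $ 1) * w' (p $ 1) / (p $ 2)\<^sup>2"
  for p :: "complex ^ 2" and y y' w w' :: "complex \<Rightarrow> complex"

lemma has_derivative_comp_vec_nth:
  fixes f :: "complex \<Rightarrow> complex" and p :: "complex ^ 'n"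
  assumes "(f has_field_derivative f') (at (p $ i))"
  shows "((\<lambda>q. f (q $ i)) has_derivative (\<lambda>v. f' * v $ i)) (at p)"
  using has_derivative_compose[OF bounded_linear_imp_has_derivative[OF bounded_linear_vec_nth]
      has_field_derivative_imp_has_derivative[OF assms]] .

lemma solution_form_has_derivative:
  assumes y: "(y has_field_derivative y' (p $ 1)) (at (p $ 1))"
      "(y' has_field_derivative - h (p $ 1) * y (p $ 1)) (at (p $ 1))"
    and w: "(w has_field_derivative w' (p $ 1)) (at (p $ 1))"
      "(w' has_field_derivative - h (p $ 1) * w (p $ 1)) (at (p $ 1))"
    and x: "p $ 2 \<noteq> 0"
  shows "(solution_form y y' w w' has_derivative
      (\<lambda>v. solution_form_dz h y y' w w' p * v $ 1 + solution_form_dx y y' w w' p * v $ 2)) (at p)"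
  unfolding solution_form_def[abs_def]
  by (rule derivative_eq_intros refl y[THEN has_derivative_comp_vec_nth]
      w[THEN has_derivative_comp_vec_nth]
      bounded_linear_imp_has_derivative[OF bounded_linear_vec_nth] x)+
    (use x in \<open>auto simp: fun_eq_iff solution_form_dz_def solution_form_dx_def field_simps power2_eq_square\<close>)

text \<open>The derivative is \<open>y * w'' - w * y''\<close>, and both second derivatives carry
  the same factor \<open>- h\<close>.\<close>

lemma wronskian_constant:
  fixes h y y' w w' :: "complex \<Rightarrow> complex"
  assumes "convex S" "open S" "z\<^sub>0 \<in> S" "z \<in> S"
    and "\<And>z. z \<in> S \<Longrightarrow> (y has_field_derivative y' z) (at z)"
    and "\<And>z. z \<in> S \<Longrightarrow> (y' has_field_derivative - h z * y z) (at z)"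
    and "\<And>z. z \<in> S \<Longrightarrow> (w has_field_derivative w' z) (at z)"
    and "\<And>z. z \<in> S \<Longrightarrow> (w' has_field_derivative - h z * w z) (at z)"
  shows "y z * w' z - w z * y' z = y z\<^sub>0 * w' z\<^sub>0 - w z\<^sub>0 * y' z\<^sub>0"
proof -
  have "((\<lambda>z. y z * w' z - w z * y' z) has_field_derivative 0) (at z within S)" if "z \<in> S" for z
    by (rule derivative_eq_intros refl assms(5-8)[OF that, THEN has_field_derivative_at_within])+
      (simp add: algebra_simps)
  from has_field_derivative_zero_constant[OF \<open>convex S\<close> this]
  obtain c where "\<And>z. z \<in> S \<Longrightarrow> y z * w' z - w z * y' z = c"
    by blast
  from this[OF \<open>z \<in> S\<close>] this[OF \<open>z\<^sub>0 \<in> S\<close>] show ?thesis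
    by (simp only:)
qed

text \<open>The two excluded loci are together the zero set of one continuous function, a
  product.\<close>

lemma open_H_carrier:
  assumes "open U" "h holomorphic_on U"
  shows "open (H_carrier U h)"
proof -
  let ?V = "{p :: complex ^ 2. p $ 1 \<in> U}"
  have "open ?V"
    using \<open>open U\<close> by (rule open_vimage_vec_nth[unfolded vimage_def])
  moreover have "continuous_on ?V (\<lambda>p. p $ 2 * ((p $ 2)\<^sup>2 - h (p $ 1)))"
    by (intro continuous_intros
        continuous_on_compose2[OF holomorphic_on_imp_continuous_on[OF assms(2)]]) auto
  ultimately have "open (?V \<inter> (\<lambda>p. p $ 2 * ((p $ 2)\<^sup>2 - h (p $ 1))) -` (- {0}))"
    by (intro continuous_open_preimage) auto
  also have "?V \<inter> (\<lambda>p. p $ 2 * ((p $ 2)\<^sup>2 - h (p $ 1))) -` (- {0}) = H_carrier U h"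
    by (auto simp: H_carrier_def)
  finally show ?thesis .
qed

text \<open>The solutions restrict only the base coordinate to a small disc. The sphere equation and
  the pullback identity hold over all of \<open>S\<close>; the final ball serves to make the map
  injective.\<close>

lemma H_carrier_locally_isometric_to_sphere:
  assumes "open U" and h: "h holomorphic_on U"
  shows "locally_isometric_to_sphere (G_metric h) (H_carrier U h)"
  unfolding locally_isometric_to_sphere_def
proof
  fix p\<^sub>0 assume p\<^sub>0: "p\<^sub>0 \<in> H_carrier U h"
  define z\<^sub>0 where "z\<^sub>0 = p\<^sub>0 $ 1"
  have "z\<^sub>0 \<in> U"
    using p\<^sub>0 by (simp add: H_carrier_def z\<^sub>0_def)
  then obtain r where r: "0 < r" "ball z\<^sub>0 r \<subseteq> U"
    using \<open>open U\<close> by (meson open_contains_ball)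
  have h_ball: "h holomorphic_on ball z\<^sub>0 r"
    using h r(2) by (rule holomorphic_on_subset)
  \<comment> \<open>The initial data (1, 0) here and (0, 1) for \<open>w\<close> make the Wronskian
    equal to 1.\<close>
  obtain \<rho>1 y y' where \<rho>1: "0 < \<rho>1" "\<rho>1 \<le> r" and y0: "y z\<^sub>0 = 1" "y' z\<^sub>0 = 0"
    and y: "\<And>z. z \<in> ball z\<^sub>0 \<rho>1 \<Longrightarrow> (y has_field_derivative y' z) (at z)"
      "\<And>z. z \<in> ball z\<^sub>0 \<rho>1 \<Longrightarrow> (y' has_field_derivative - h z * y z) (at z)"
    using linear_ode_solution_near_point[OF h_ball r(1)] by metis
  obtain \<rho>2 w w' where \<rho>2: "0 < \<rho>2" "\<rho>2 \<le> r" and w0: "w z\<^sub>0 = 0" "w' z\<^sub>0 = 1"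
    and w: "\<And>z. z \<in> ball z\<^sub>0 \<rho>2 \<Longrightarrow> (w has_field_derivative w' z) (at z)"
      "\<And>z. z \<in> ball z\<^sub>0 \<rho>2 \<Longrightarrow> (w' has_field_derivative - h z * w z) (at z)"
    using linear_ode_solution_near_point[OF h_ball r(1)] by metis
  define V where "V = ball z\<^sub>0 (min \<rho>1 \<rho>2)"
  have V: "convex V" "open V" "z\<^sub>0 \<in> V"
    using \<rho>1(1) \<rho>2(1) by (auto simp: V_def)
  have yV: "\<And>z. z \<in> V \<Longrightarrow> (y has_field_derivative y' z) (at z)"
      "\<And>z. z \<in> V \<Longrightarrow> (y' has_field_derivative - h z * y z) (at z)"
      "\<And>z. z \<in> V \<Longrightarrow> (w has_field_derivative w' z) (at z)"
      "\<And>z. z \<in> V \<Longrightarrow> (w' has_field_derivative - h z * w z) (at z)"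
    using y w by (auto simp: V_def)
  have wronskian: "y z * w' z = 1 + w z * y' z" if "z \<in> V" for z
    using wronskian_constant[OF V that yV] by (simp add: y0 w0 algebra_simps)
  define S where "S = {p. p $ 1 \<in> V} \<inter> H_carrier U h"
  have "open S"
    unfolding S_def using open_H_carrier[OF assms] open_vimage_vec_nth[OF V(2), unfolded vimage_def]
    by (rule open_Int[rotated])
  have "p\<^sub>0 \<in> S"
    using p\<^sub>0 V(3) by (simp add: S_def z\<^sub>0_def)

  define a where "a = solution_form y y' y y'"
  define b where "b = solution_form w w' w w'"
  define c where "c = solution_form y y' w w'"
  \<comment> \<open>A linear change of coordinates diagonalising the quadratic form
    \<open>c\<^sup>2 - a * b\<close>: the squares of the first two entries add up to
    \<open>- a * b\<close>.\<close>
  define \<Phi> :: "complex ^ 2 \<Rightarrow> complex ^ 3" where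
    "\<Phi> p = vector [(a p - b p) / 2, (a p + b p) / (2 * \<i>), c p]" for p
  define az bz cz ax bx cx where d_defs:
    "az = solution_form_dz h y y' y y'" "bz = solution_form_dz h w w' w w'"
    "cz = solution_form_dz h y y' w w'"
    "ax = solution_form_dx y y' y y'" "bx = solution_form_dx w w' w w'"
    "cx = solution_form_dx y y' w w'"
  define J :: "complex ^ 2 \<Rightarrow> complex ^ 2 ^ 3" where
    "J p = vector [vector [(az p - bz p) / 2, (ax p - bx p) / 2],
                   vector [(az p + bz p) / (2 * \<i>), (ax p + bx p) / (2 * \<i>)],
                   vector [cz p, cx p]]" for p

  have der: "(\<Phi> has_derivative (\<lambda>v. J p *v v)) (at p)" if "p \<in> S" for p
  proof (rule has_derivative_matrixI)
    have p: "p $ 1 \<in> V" "p $ 2 \<noteq> 0"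
      using that by (auto simp: S_def H_carrier_def)
    have abc: "(a has_derivative (\<lambda>v. az p * v $ 1 + ax p * v $ 2)) (at p)"
      "(b has_derivative (\<lambda>v. bz p * v $ 1 + bx p * v $ 2)) (at p)"
      "(c has_derivative (\<lambda>v. cz p * v $ 1 + cx p * v $ 2)) (at p)"
      unfolding a_def b_def c_def d_defs
      by (intro solution_form_has_derivative yV[OF p(1)] p(2))+
    have J: "(\<lambda>v. (J p *v v) $ 1) =
          (\<lambda>v. (az p * v $ 1 + ax p * v $ 2 - (bz p * v $ 1 + bx p * v $ 2)) / 2)"
        "(\<lambda>v. (J p *v v) $ 2) =
          (\<lambda>v. (az p * v $ 1 + ax p * v $ 2 + (bz p * v $ 1 + bx p * v $ 2)) / (2 * \<i>))"
        "(\<lambda>v. (J p *v v) $ 3) = (\<lambda>v. cz p * v $ 1 + cx p * v $ 2)"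
      by (simp_all add: J_def matrix_vector_mult_def sum_2 fun_eq_iff algebra_simps
          add_divide_distrib diff_divide_distrib)
    have "\<forall>k. ((\<lambda>q. \<Phi> q $ k) has_derivative (\<lambda>v. (J p *v v) $ k)) (at p)"
      unfolding forall_3 \<Phi>_def vector_3 J
      by (intro conjI bounded_linear.has_derivative[OF bounded_linear_divide]
          has_derivative_diff has_derivative_add abc)
    then show "((\<lambda>q. \<Phi> q $ k) has_derivative (\<lambda>v. (J p *v v) $ k)) (at p)" for k
      by blast
  qed
  have metric: "transpose (J p) ** J p = G_metric h p" if "p \<in> S" for p
  proof -
    define x z k where xz: "x = p $ 2" "z = p $ 1" "k = x - h z / x"
    have x: "x \<noteq> 0" and W: "y z * w' z = 1 + w z * y' z"
      using that wronskian by (auto simp: S_def H_carrier_def xz)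
    \<comment> \<open>The pullback is the form \<open>c\<^sup>2 - a * b\<close> and its
      polarisation, evaluated on the columns of partial derivatives of \<open>a\<close>,
      \<open>b\<close>, \<open>c\<close>.\<close>
    have entries: "transpose (J p) ** J p =
        vector [vector [(cz p)\<^sup>2 - az p * bz p, cz p * cx p - (az p * bx p + ax p * bz p) / 2],
                vector [cz p * cx p - (az p * bx p + ax p * bz p) / 2, (cx p)\<^sup>2 - ax p * bx p]]"
      by (simp add: vec_eq_iff forall_2 matrix_matrix_mult_def transpose_def sum_3 J_def
          field_simps power2_eq_square)
    have z_eqs: "az p = k * (2 * y z * y' z)" "bz p = k * (2 * w z * w' z)"
        "cz p = k * (y z * w' z + y' z * w z)"
      and x_eqs: "ax p = (y z)\<^sup>2 - (y' z)\<^sup>2 / x\<^sup>2" "bx p = (w z)\<^sup>2 - (w' z)\<^sup>2 / x\<^sup>2"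
        "cx p = y z * w z - y' z * w' z / x\<^sup>2"
      by (simp_all add: d_defs solution_form_dz_def solution_form_dx_def xz power2_eq_square
          algebra_simps)
    \<comment> \<open>The square of the sum \<open>y * w' + y' * w\<close> minus four times the
      product of its terms is the square of their difference, the Wronskian.\<close>
    have "(cz p)\<^sup>2 - az p * bz p = k\<^sup>2 * (y z * w' z - w z * y' z)\<^sup>2"
      unfolding z_eqs by algebra
    also have "\<dots> = (h z - x\<^sup>2)\<^sup>2 / x\<^sup>2"
      unfolding W using x by (simp add: xz(3) field_simps power2_eq_square)
    finally have e11: "(cz p)\<^sup>2 - az p * bz p = (h z - x\<^sup>2)\<^sup>2 / x\<^sup>2" .
    have "(cx p)\<^sup>2 - ax p * bx p = (y z * w' z - w z * y' z)\<^sup>2 / x\<^sup>2"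
      unfolding x_eqs using x by (simp add: field_simps power2_eq_square)
    also have "\<dots> = 1 / x\<^sup>2"
      unfolding W by simp
    finally have e22: "(cx p)\<^sup>2 - ax p * bx p = 1 / x\<^sup>2" .
    have e12: "cz p * cx p - (az p * bx p + ax p * bz p) / 2 = 0"
      unfolding z_eqs x_eqs using x by (simp add: field_simps power2_eq_square)
    show ?thesis
      unfolding entries e11 e12 e22 G_metric_def xz ..
  qed
  have sphere: "\<Phi> p \<in> imaginary_unit_sphere" if "p \<in> S" for p
  proof -
    have x: "p $ 2 \<noteq> 0" and W: "y (p $ 1) * w' (p $ 1) = 1 + w (p $ 1) * y' (p $ 1)"
      using that wronskian by (auto simp: S_def H_carrier_def)
    have "((a p - b p) / 2)\<^sup>2 + ((a p + b p) / (2 * \<i>))\<^sup>2 + (c p)\<^sup>2 = (c p)\<^sup>2 - a p * b p"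
      by (simp add: field_simps power2_eq_square)
    \<comment> \<open>The powers of the fibre coordinate cancel, leaving minus the squared
      Wronskian, that is -1.\<close>
    also have "\<dots> = - (y (p $ 1) * w' (p $ 1) - w (p $ 1) * y' (p $ 1))\<^sup>2"
      using x by (simp add: a_def b_def c_def solution_form_def field_simps power2_eq_square)
    finally show ?thesis
      by (simp add: imaginary_unit_sphere_def \<Phi>_def W)
  qed
  have cont: "continuous (at p\<^sub>0) (\<lambda>p. J p $ i $ j)" for i j
  proof -
    have p: "p\<^sub>0 $ 1 \<in> V" "p\<^sub>0 $ 2 \<noteq> 0" "p\<^sub>0 $ 1 \<in> U"
      using p\<^sub>0 V(3) by (auto simp: z\<^sub>0_def H_carrier_def)
    note DERIV_isCont[OF holomorphic_derivI[OF h \<open>open U\<close> p(3)]] yV[OF p(1), THEN DERIV_isCont]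
    note cont = this[THEN isCont_o2[OF isCont_vec_nth[OF continuous_ident]]]
    have "continuous (at p\<^sub>0) (solution_form_dz h u u' v v')" "continuous (at p\<^sub>0) (solution_form_dx u u' v v')"
      if "isCont (\<lambda>p. u (p $ 1)) p\<^sub>0" "isCont (\<lambda>p. u' (p $ 1)) p\<^sub>0"
        "isCont (\<lambda>p. v (p $ 1)) p\<^sub>0" "isCont (\<lambda>p. v' (p $ 1)) p\<^sub>0" for u u' v v'
      unfolding solution_form_dz_def[abs_def] solution_form_dx_def[abs_def] using p(2)
      by (intro continuous_intros cont that; simp)+
    then have "continuous (at p\<^sub>0) az" "continuous (at p\<^sub>0) bz" "continuous (at p\<^sub>0) cz"
      "continuous (at p\<^sub>0) ax" "continuous (at p\<^sub>0) bx" "continuous (at p\<^sub>0) cx"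
      unfolding d_defs using cont by blast+
    then have "\<forall>i j. continuous (at p\<^sub>0) (\<lambda>p. J p $ i $ j)"
      by (simp add: forall_3 forall_2 J_def continuous_intros)
    then show ?thesis
      by blast
  qed
  \<comment> \<open>The pullback identity itself provides a left inverse of the Jacobian, since the
    metric is invertible.\<close>
  have "matrix_inv (G_metric h p\<^sub>0) ** transpose (J p\<^sub>0) ** J p\<^sub>0 = mat 1"
    using p\<^sub>0 matrix_inv_G_metric(1)[of p\<^sub>0 h] metric[OF \<open>p\<^sub>0 \<in> S\<close>]
    by (simp add: H_carrier_def flip: matrix_mul_assoc)
  from locally_injective_of_matrix_derivative[OF \<open>open S\<close> \<open>p\<^sub>0 \<in> S\<close> der cont this]
  obtain t where t: "0 < t" "ball p\<^sub>0 t \<subseteq> S" "inj_on \<Phi> (ball p\<^sub>0 t)"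
    by metis
  have "holomorphic_isometry_to_sphere (G_metric h) (ball p\<^sub>0 t) \<Phi>"
    unfolding holomorphic_isometry_to_sphere_def using t(2,3) sphere der metric by blast
  moreover have "ball p\<^sub>0 t \<subseteq> H_carrier U h"
    using t(2) by (auto simp: S_def)
  ultimately show "\<exists>W \<Phi>. open W \<and> p\<^sub>0 \<in> W \<and> W \<subseteq> H_carrier U h
      \<and> holomorphic_isometry_to_sphere (G_metric h) W \<Phi>"
    using t(1) by (intro exI[of _ "ball p\<^sub>0 t"] exI[of _ \<Phi>]) auto
qed

theorem theorem9:
  fixes h X :: "complex \<Rightarrow> complex" and U U\<^sub>0 :: "complex set"
  assumes "open U" and "h holomorphic_on U"
    and "open U\<^sub>0" and "U\<^sub>0 \<subseteq> U"
    and "X holomorphic_on U\<^sub>0"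
    and "\<forall>z\<in>U\<^sub>0. X z \<noteq> 0"
    and "\<forall>z\<in>U\<^sub>0. h z \<noteq> (X z)\<^sup>2"
    and "riccati_solution h U\<^sub>0 (\<lambda>z. \<i> * X z) \<or> riccati_solution h U\<^sub>0 (\<lambda>z. - \<i> * X z)"
  shows "(\<forall>z\<in>U\<^sub>0. deriv (deriv X) z =
            (3 * (X z)\<^sup>2 + h z) / ((X z)\<^sup>2 - h z) * ((deriv X z)\<^sup>2 / X z)
            - deriv h z * deriv X z / ((X z)\<^sup>2 - h z)
            + ((X z) ^ 4 - (h z)\<^sup>2) / X z)
       \<and> explicit_geodesic (G_metric h) (H_carrier U h) U\<^sub>0 X
       \<and> locally_isometric_to_sphere (G_metric h) (H_carrier U h)"
proof -
  have hX: "X z \<noteq> 0" "h z \<noteq> (X z)\<^sup>2" if "z \<in> U\<^sub>0" for z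
    using assms(6,7) that by auto
  have h: "h holomorphic_on U\<^sub>0"
    using assms(2,4) by (rule holomorphic_on_subset)
  \<comment> \<open>Both signs are treated at once: only \<open>s\<^sup>2 = -1\<close> is used from
    here on.\<close>
  obtain s where s: "s\<^sup>2 = -1" "riccati_solution h U\<^sub>0 (\<lambda>z. s * X z)"
    using assms(8) by (metis power2_i power2_minus)
  have dX: "deriv X z = s * (h z - (X z)\<^sup>2)" if "z \<in> U\<^sub>0" for z
  proof -
    have deriv_sX: "deriv (\<lambda>z. s * X z) z = s * deriv X z"
      using holomorphic_on_imp_differentiable_at[OF assms(5,3) that] by (rule deriv_cmult)
    have "deriv (\<lambda>z. s * X z) z + (s * X z)\<^sup>2 + h z = 0"
      using s(2) that unfolding riccati_solution_def by blast
    then have "s * deriv X z + s\<^sup>2 * (X z)\<^sup>2 + h z = 0"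
      unfolding deriv_sX power_mult_distrib .
    then have "s * deriv X z = (X z)\<^sup>2 - h z"
      unfolding s(1) by (simp add: algebra_simps)
    \<comment> \<open>Multiplication by \<open>s\<close> replaces a division, because
      \<open>s\<close> is the negative of its own inverse.\<close>
    then have "s * (s * deriv X z) = s * ((X z)\<^sup>2 - h z)"
      by (rule arg_cong)
    moreover have "s * (s * deriv X z) = s\<^sup>2 * deriv X z"
      by (simp add: power2_eq_square)
    ultimately have "- deriv X z = s * ((X z)\<^sup>2 - h z)"
      using s(1) by simp
    then show ?thesis
      by (simp add: minus_equation_iff[of "deriv X z"] right_diff_distrib)
  qed
  show ?thesis
    using riccati_second_derivative[OF assms(3) h assms(5) s(1) dX]
      graph_explicit_geodesic[OF assms(3) h assms(5) hX s(1) dX assms(4)]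
      H_carrier_locally_isometric_to_sphere[OF assms(1,2)] hX
    by blast
qed

end
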